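(* Let $p,q,r\geq 1$ be integers and let $$M_{p,q,r}=\sum_{i=1}^p\sum_{j=1}^q\sum_{k=1}^r e_{i,j}\otimes e_{j,k}\otimes e_{k,i}\in\mathbb{C}^{p\times q}\otimes\mathbb{C}^{q\times r}\otimes\mathbb{C}^{r\times p}.$$ Then $\|M_{p,q,r}\|_\star=pqr$ and $[M_{p,q,r}]=1$.
   Context: $\mathbb{C}^{a\times b}$ is the space of complex $a\times b$ matrices with Hermitian form $\langle A,B\rangle=\operatorname{trace}(AB^\star)$; $e_{i,j}$ is the matrix with a $1$ in position $(i,j)$ and zeroes elsewhere. For a tensor product $V=V^{(1)}\otimes\cdots\otimes V^{(d)}$ of finite dimensional Hilbert spaces (with the induced Hermitian form), a pure tensor is an element of the form $v^{(1)}\otimes\cdots\otimes v^{(d)}$ with $v^{(e)}\in V^{(e)}$. The nuclear norm $\|T\|_\star$ of $T\in V$ is the smallest possible value of $\sum_{i=1}^m\|v_i\|$ over all decompositions $T=\sum_{i=1}^m v_i$ ($m$ arbitrary) into pure tensors. The spectral norm $[T]$ is the maximum of $|\langle T,u\rangle|$ over all pure tensors $u\in V$ of unit length. *)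

theory Defs
  imports "HOL-Analysis.Analysis"
begin

text \<open>
  The space of complex \<open>a \<times> b\<close> matrices is the library type \<open>complex ^ 'b ^ 'a\<close>; its
  norm is the Frobenius norm. A tensor in the product of three matrix spaces is given by its
  coordinates with respect to the basis formed by the tensor products of matrix units
  (lemma \<open>tensor3_matrix_unit\<close>), so the product space is a coordinate space indexed by
  triples of matrix positions.
\<close>

type_synonym ('a, 'b, 'c, 'd, 'e, 'f) tensor3 =
  "complex ^ (('a \<times> 'b) \<times> ('c \<times> 'd) \<times> ('e \<times> 'f))"

definition matrix_unit :: "'a \<Rightarrow> 'b \<Rightarrow> complex ^ 'b::finite ^ 'a::finite"
  where "matrix_unit i j = (\<chi> k l. if k = i \<and> l = j then 1 else 0)"

definition conj_transpose :: "complex ^ 'b::finite ^ 'a::finite \<Rightarrow> complex ^ 'a ^ 'b"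
  where "conj_transpose A = (\<chi> i j. cnj (A $ j $ i))"

definition matrix_hform ::
    "complex ^ 'b::finite ^ 'a::finite \<Rightarrow> complex ^ 'b ^ 'a \<Rightarrow> complex"
  where "matrix_hform A B = trace (A ** conj_transpose B)"

definition tensor3 ::
    "complex ^ 'b::finite ^ 'a::finite \<Rightarrow> complex ^ 'd::finite ^ 'c::finite \<Rightarrow>
     complex ^ 'f::finite ^ 'e::finite \<Rightarrow> ('a, 'b, 'c, 'd, 'e, 'f) tensor3"
  where "tensor3 A B C = (\<chi> x. case x of ((i, j), (k, l), (m, n)) \<Rightarrow>
           A $ i $ j * B $ k $ l * C $ m $ n)"

text \<open>
  The standard Hermitian form on coordinates. It is sesquilinear and is multiplicative on pure
  tensors (lemma \<open>hform_tensor3\<close>), hence it is the form induced by those on the factors.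
  The library norm on tensors is the norm of this form (lemma \<open>hform_self\<close>).
\<close>

definition hform :: "complex ^ 'n::finite \<Rightarrow> complex ^ 'n \<Rightarrow> complex"
  where "hform S T = (\<Sum>x\<in>UNIV. S $ x * cnj (T $ x))"

definition pure_tensors ::
    "('a::finite, 'b::finite, 'c::finite, 'd::finite, 'e::finite, 'f::finite) tensor3 set"
  where "pure_tensors = {tensor3 A B C | A B C. True}"

text \<open>
  The minimum and the maximum below are taken literally: a value can only be derived for
  \<open>LEAST\<close> and \<open>GREATEST\<close> by showing that it is attained.
\<close>

definition nuclear_norm ::
    "('a::finite, 'b::finite, 'c::finite, 'd::finite, 'e::finite, 'f::finite) tensor3 \<Rightarrow> real"
  where "nuclear_norm T =
    (LEAST s. \<exists>(m::nat) v. (\<forall>i<m. v i \<in> pure_tensors) \<and> T = (\<Sum>i<m. v i) \<and>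
                    s = (\<Sum>i<m. norm (v i)))"

definition spectral_norm ::
    "('a::finite, 'b::finite, 'c::finite, 'd::finite, 'e::finite, 'f::finite) tensor3 \<Rightarrow> real"
  where "spectral_norm T =
    (GREATEST s. \<exists>u\<in>pure_tensors. norm u = 1 \<and> s = cmod (hform T u))"

definition matmul_tensor ::
    "('p::finite, 'q::finite, 'q, 'r::finite, 'r, 'p) tensor3"
  where "matmul_tensor =
    (\<Sum>i\<in>UNIV. \<Sum>j\<in>UNIV. \<Sum>k\<in>UNIV.
       tensor3 (matrix_unit i j) (matrix_unit j k) (matrix_unit k i))"


lemma tensor3_matrix_unit:
  "tensor3 (matrix_unit i j) (matrix_unit k l) (matrix_unit m n) =
   axis ((i, j), (k, l), (m, n)) 1"
  by (auto simp: tensor3_def matrix_unit_def axis_def vec_eq_iff)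

lemma matrix_hform_sum: "matrix_hform A B = (\<Sum>i\<in>UNIV. \<Sum>j\<in>UNIV. A $ i $ j * cnj (B $ i $ j))"
  by (simp add: matrix_hform_def trace_def matrix_matrix_mult_def conj_transpose_def)

lemma hform_tensor3:
  "hform (tensor3 A B C) (tensor3 A' B' C') =
   matrix_hform A A' * matrix_hform B B' * matrix_hform C C'"
proof -
  let ?f = "\<lambda>A A' x. A $ fst x $ snd x * cnj (A' $ fst x $ snd x)"
  have 1: "matrix_hform A B = (\<Sum>x\<in>UNIV. ?f A B x)"
    for A B :: "complex ^ 'x::finite ^ 'y::finite"
    by (simp add: matrix_hform_sum sum.cartesian_product UNIV_Times_UNIV[symmetric]
        case_prod_unfold del: UNIV_Times_UNIV)
  have "hform (tensor3 A B C) (tensor3 A' B' C') =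
      (\<Sum>x\<in>UNIV. \<Sum>y\<in>UNIV. \<Sum>z\<in>UNIV. ?f A A' x * (?f B B' y * ?f C C' z))"
    by (simp add: hform_def tensor3_def sum.cartesian_product UNIV_Times_UNIV[symmetric]
        case_prod_unfold mult_ac del: UNIV_Times_UNIV)
  also have "\<dots> = matrix_hform A A' * (matrix_hform B B' * matrix_hform C C')"
    by (simp add: 1 flip: sum_distrib_left sum_distrib_right)
  finally show ?thesis by (simp add: mult.assoc)
qed

lemma hform_self: "hform T T = of_real ((norm T)\<^sup>2)"
  by (simp add: hform_def norm_vec_def L2_set_def sum_nonneg complex_norm_square del: of_real_power)

end

theory Submission
  imports Defs
begin

text \<open>
  Pairing \<open>M\<close> with \<open>A \<otimes> B \<otimes> C\<close> gives the conjugate of \<open>trace (ABC)\<close>, which two applications of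
  Cauchy--Schwarz bound by the product of the Frobenius norms; a single matrix unit per factor
  attains the bound, so the spectral norm is 1. The spectral and nuclear norms are dual:
  pairing \<open>M\<close> with any decomposition of itself gives \<open>pqr = \<langle>M, M\<rangle> \<le> \<Sum> \<parallel>v\<^sub>i\<parallel>\<close>,
  and the defining decomposition of \<open>M\<close> into \<open>pqr\<close> unit tensors attains this.
\<close>

lemma hform_sum_left: "hform (\<Sum>i\<in>I. f i) T = (\<Sum>i\<in>I. hform (f i) T)"
  unfolding hform_def by (subst sum.swap) (simp add: sum_distrib_right)

lemma hform_sum_right: "hform S (\<Sum>i\<in>I. f i) = (\<Sum>i\<in>I. hform S (f i))"
  unfolding hform_def by (subst sum.swap) (simp add: sum_distrib_left)

lemma hform_axis_left: "hform (axis x 1) T = cnj (T $ x)"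
  by (simp add: hform_def axis_def if_distrib[of "\<lambda>z. z * _"] cong: if_cong)

lemma norm_matrix_sum: "norm A = sqrt (\<Sum>i\<in>UNIV. \<Sum>j\<in>UNIV. (cmod (A $ i $ j))\<^sup>2)"
  for A :: "complex ^ 'b::finite ^ 'a::finite"
  by (simp add: norm_vec_def L2_set_def sum_nonneg)

lemma matrix_hform_self: "matrix_hform A A = of_real ((norm A)\<^sup>2)"
  by (simp add: matrix_hform_sum norm_matrix_sum sum_nonneg complex_norm_square
      del: of_real_power)

text \<open>The Hermitian form is multiplicative on pure tensors; pairing a pure tensor with itself
  gives the squared identity, and both sides are nonnegative.\<close>

lemma norm_tensor3: "norm (tensor3 A B C) = norm A * norm B * norm C"
proof -
  have "complex_of_real ((norm (tensor3 A B C))\<^sup>2) = of_real ((norm A * norm B * norm C)\<^sup>2)"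
    by (simp only: hform_self[symmetric] hform_tensor3 matrix_hform_self power_mult_distrib
        of_real_mult)
  then have "(norm (tensor3 A B C))\<^sup>2 = (norm A * norm B * norm C)\<^sup>2"
    by (simp only: of_real_eq_iff)
  then show ?thesis by (simp add: power2_eq_iff_nonneg)
qed

lemma norm_matrix_unit: "norm (matrix_unit i j) = 1"
proof -
  have "(\<Sum>k\<in>UNIV. \<Sum>l\<in>UNIV. (cmod (matrix_unit i j $ k $ l))\<^sup>2) =
      (\<Sum>k\<in>UNIV. \<Sum>l\<in>UNIV. if l = j then if k = i then 1 else 0 else 0)"
    by (intro sum.cong refl) (simp add: matrix_unit_def)
  then show ?thesis by (simp add: norm_matrix_sum)
qed

text \<open>Cauchy--Schwarz is applied twice: over \<open>j\<close> with \<open>i\<close> and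
  \<open>k\<close> fixed, then over the pairs \<open>(i, k)\<close> against the entries of
  \<open>C\<close>.\<close>

lemma sum_triple_product_le:
  fixes A :: "complex ^ 'q::finite ^ 'p::finite" and B :: "complex ^ 'r::finite ^ 'q"
    and C :: "complex ^ 'p ^ 'r"
  shows "(\<Sum>i\<in>UNIV. \<Sum>j\<in>UNIV. \<Sum>k\<in>UNIV. cmod (A $ i $ j) * cmod (B $ j $ k) * cmod (C $ k $ i))
    \<le> norm A * norm B * norm C" (is "?l \<le> _")
proof -
  \<comment> \<open>\<open>a i\<close> is the norm of row \<open>i\<close> of \<open>A\<close>,
    \<open>b k\<close> that of column \<open>k\<close> of \<open>B\<close>; their squares sum to the
    squared Frobenius norms.\<close>
  define a where "a i = L2_set (\<lambda>j. cmod (A $ i $ j)) UNIV" for i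
  define b where "b k = L2_set (\<lambda>j. cmod (B $ j $ k)) UNIV" for k
  have a2: "(\<Sum>i\<in>UNIV. (a i)\<^sup>2) = (norm A)\<^sup>2"
    by (simp add: a_def L2_set_def norm_matrix_sum sum_nonneg)
  have b2: "(\<Sum>k\<in>UNIV. (b k)\<^sup>2) = (norm B)\<^sup>2"
    unfolding norm_matrix_sum b_def L2_set_def
    by (subst sum.swap) (simp add: sum_nonneg)
  have "?l = (\<Sum>i\<in>UNIV. \<Sum>k\<in>UNIV. (\<Sum>j\<in>UNIV. cmod (A $ i $ j) * cmod (B $ j $ k)) * cmod (C $ k $ i))"
    by (rule sum.cong[OF refl], subst sum.swap) (simp add: sum_distrib_right)
  also have "\<dots> \<le> (\<Sum>i\<in>UNIV. \<Sum>k\<in>UNIV. (a i * b k) * cmod (C $ k $ i))"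
    unfolding a_def b_def
    using L2_set_mult_ineq[of "\<lambda>j. cmod (A $ i $ j)" "\<lambda>j. cmod (B $ j $ k)" UNIV for i k]
    by (intro sum_mono mult_right_mono) simp_all
  \<comment> \<open>All factors are nonnegative; the absolute values only match the form of
    \<open>L2_set_mult_ineq\<close>.\<close>
  also have "\<dots> = (\<Sum>x\<in>UNIV. \<bar>a (fst x) * b (snd x)\<bar> * \<bar>cmod (C $ snd x $ fst x)\<bar>)"
    by (simp add: sum.cartesian_product case_prod_unfold a_def b_def abs_mult)
  also have "\<dots> \<le> L2_set (\<lambda>x. a (fst x) * b (snd x)) UNIV * L2_set (\<lambda>x. cmod (C $ snd x $ fst x)) UNIV"
    by (rule L2_set_mult_ineq)
  also have "L2_set (\<lambda>x. a (fst x) * b (snd x)) UNIV = sqrt (\<Sum>i\<in>UNIV. \<Sum>k\<in>UNIV. (a i)\<^sup>2 * (b k)\<^sup>2)"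
    by (simp add: L2_set_def sum.cartesian_product case_prod_unfold power_mult_distrib)
  also have "\<dots> = norm A * norm B"
    by (simp add: a2 b2 real_sqrt_mult flip: sum_product)
  also have "L2_set (\<lambda>x. cmod (C $ snd x $ fst x)) UNIV = sqrt (\<Sum>i\<in>UNIV. \<Sum>k\<in>UNIV. (cmod (C $ k $ i))\<^sup>2)"
    by (simp add: L2_set_def sum.cartesian_product case_prod_unfold)
  also have "\<dots> = norm C"
    unfolding norm_matrix_sum by (subst sum.swap) simp
  finally show ?thesis .
qed

text \<open>\<open>matmul_tensor\<close> is a sum of coordinate basis vectors, and pairing with each
  of them reads off one conjugated entry.\<close>

lemma hform_matmul_tensor_left:
  "hform matmul_tensor T = (\<Sum>i\<in>UNIV. \<Sum>j\<in>UNIV. \<Sum>k\<in>UNIV. cnj (T $ ((i, j), (j, k), (k, i))))"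
  by (simp add: matmul_tensor_def tensor3_matrix_unit hform_sum_left hform_axis_left)

text \<open>This bound serves twice: as the upper bound for the spectral norm and, applied to each
  summand of a decomposition, as the lower bound for the nuclear norm.\<close>

lemma cmod_hform_matmul_tensor_le:
  assumes "u \<in> pure_tensors"
  shows "cmod (hform matmul_tensor u) \<le> norm u"
proof -
  obtain A B C where u: "u = tensor3 A B C"
    using assms by (auto simp: pure_tensors_def)
  have "cmod (hform matmul_tensor u) \<le>
      (\<Sum>i\<in>UNIV. \<Sum>j\<in>UNIV. \<Sum>k\<in>UNIV. cmod (A $ i $ j) * cmod (B $ j $ k) * cmod (C $ k $ i))"
    unfolding hform_matmul_tensor_left u
    by (intro order_trans[OF norm_sum] sum_mono) (simp add: tensor3_def norm_mult)
  also have "\<dots> \<le> norm u"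
    unfolding u norm_tensor3 by (rule sum_triple_product_le)
  finally show ?thesis .
qed

lemma matmul_tensor_component: "matmul_tensor $ ((i, j), (j, k), (k, i)) = 1"
proof -
  \<comment> \<open>Distinct triples give distinct positions, so one summand survives; nesting the
    conditionals lets each sum collapse separately.\<close>
  have "matmul_tensor $ ((i, j), (j, k), (k, i)) =
      (\<Sum>i'\<in>UNIV. \<Sum>j'\<in>UNIV. \<Sum>k'\<in>UNIV.
         if k' = k then if j' = j then if i' = i then 1 else 0 else 0 else 0)"
    unfolding matmul_tensor_def tensor3_matrix_unit sum_component
    by (intro sum.cong refl) (simp add: axis_def)
  then show ?thesis by simp
qed

lemma hform_matmul_tensor_self:
  "hform matmul_tensor (matmul_tensor ::
      ('p::finite, 'q::finite, 'q, 'r::finite, 'r, 'p) tensor3) =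
    of_real (real CARD('p) * real CARD('q) * real CARD('r))"
  by (simp add: hform_matmul_tensor_left matmul_tensor_component)

lemma spectral_norm_matmul_tensor:
  "spectral_norm (matmul_tensor ::
      ('p::finite, 'q::finite, 'q, 'r::finite, 'r, 'p) tensor3) = 1"
  (is "spectral_norm ?M = 1")
  unfolding spectral_norm_def
proof (rule Greatest_equality)
  \<comment> \<open>Any indices will do, since types are nonempty.\<close>
  obtain i :: 'p and j :: 'q and k :: 'r where True by blast
  let ?u = "tensor3 (matrix_unit i j) (matrix_unit j k) (matrix_unit k i)"
  \<comment> \<open>Conjugate symmetry moves the basis vector \<open>?u\<close> to the left, where
    \<open>hform_axis_left\<close> applies.\<close>
  have "hform matmul_tensor ?u = cnj (hform ?u matmul_tensor)"
    by (simp add: hform_def mult.commute)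
  then have "cmod (hform matmul_tensor ?u) = 1"
    by (simp add: tensor3_matrix_unit hform_axis_left matmul_tensor_component)
  moreover have "?u \<in> pure_tensors" by (auto simp: pure_tensors_def)
  moreover have "norm ?u = 1" by (simp add: norm_tensor3 norm_matrix_unit)
  ultimately show "\<exists>u\<in>pure_tensors. norm u = 1 \<and> 1 = cmod (hform ?M u)"
    by metis
qed (use cmod_hform_matmul_tensor_le in fastforce)

lemma nuclear_norm_matmul_tensor:
  "nuclear_norm (matmul_tensor ::
      ('p::finite, 'q::finite, 'q, 'r::finite, 'r, 'p) tensor3) =
    real CARD('p) * real CARD('q) * real CARD('r)"
  (is "nuclear_norm ?M = ?n")
  unfolding nuclear_norm_def
proof (rule Least_equality)
  \<comment> \<open>Decompositions are indexed by an initial segment of \<open>nat\<close>, so the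
    index triples are enumerated.\<close>
  obtain h :: "nat \<Rightarrow> 'p \<times> 'q \<times> 'r" where h: "bij_betw h {..<CARD('p \<times> 'q \<times> 'r)} UNIV"
    using ex_bij_betw_nat_finite[of "UNIV :: ('p \<times> 'q \<times> 'r) set"]
    by (auto simp: atLeast0LessThan)
  define w :: "'p \<times> 'q \<times> 'r \<Rightarrow> ('p, 'q, 'q, 'r, 'r, 'p) tensor3" where
    "w = (\<lambda>(i, j, k). tensor3 (matrix_unit i j) (matrix_unit j k) (matrix_unit k i))"
  have "w x \<in> pure_tensors" for x
    by (auto simp: w_def pure_tensors_def split: prod.splits)
  moreover have "?M = (\<Sum>l<CARD('p \<times> 'q \<times> 'r). w (h l))"
    unfolding sum.reindex_bij_betw[OF h]
    by (simp add: matmul_tensor_def w_def sum.cartesian_product)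
  moreover have "?n = (\<Sum>l<CARD('p \<times> 'q \<times> 'r). norm (w (h l)))"
    by (simp add: w_def case_prod_unfold norm_tensor3 norm_matrix_unit)
  ultimately show "\<exists>(m::nat) v. (\<forall>i<m. v i \<in> pure_tensors) \<and> ?M = (\<Sum>i<m. v i) \<and>
      ?n = (\<Sum>i<m. norm (v i))"
    by (intro exI[of _ "CARD('p \<times> 'q \<times> 'r)"] exI[of _ "\<lambda>l. w (h l)"] conjI allI impI)
next
  fix s assume "\<exists>(m::nat) v. (\<forall>i<m. v i \<in> pure_tensors) \<and> ?M = (\<Sum>i<m. v i) \<and>
      s = (\<Sum>i<m. norm (v i))"
  then obtain m and v :: "nat \<Rightarrow> ('p, 'q, 'q, 'r, 'r, 'p) tensor3"
    where v: "\<And>i. i < m \<Longrightarrow> v i \<in> pure_tensors" and M: "?M = (\<Sum>i<m. v i)"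
      and s: "s = (\<Sum>i<m. norm (v i))"
    by blast
  have "?n = cmod (hform ?M ?M)"
    unfolding hform_matmul_tensor_self norm_of_real by simp
  \<comment> \<open>Only the second argument is decomposed; the first stays as the dual
    certificate.\<close>
  also have "\<dots> = cmod (\<Sum>i<m. hform ?M (v i))"
    by (subst (2) M) (simp add: hform_sum_right)
  also have "\<dots> \<le> (\<Sum>i<m. cmod (hform ?M (v i)))"
    by (rule norm_sum)
  also have "\<dots> \<le> s"
    unfolding s by (intro sum_mono cmod_hform_matmul_tensor_le v) simp
  finally show "?n \<le> s" .
qed

theorem corollary1p10:
  shows "nuclear_norm (matmul_tensor ::
             ('p::finite, 'q::finite, 'q, 'r::finite, 'r, 'p) tensor3) =
           real CARD('p) * real CARD('q) * real CARD('r) \<and>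
         spectral_norm (matmul_tensor ::
             ('p::finite, 'q::finite, 'q, 'r::finite, 'r, 'p) tensor3) = 1"
  by (simp add: nuclear_norm_matmul_tensor spectral_norm_matmul_tensor)

end
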